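(* Let $n\ge 2$, $X=\{x_1,\ldots,x_n\}$, and \[ B_{n,n-1}(X)=\prod_{S\subseteq[n],\,|S|=n-1}\ \sum_{i\in S}x_i . \] Then \[ B_{n,n-1}(X)=\sum_{\lambda\vdash n} a_\lambda\, s_\lambda(x_1,\ldots,x_n), \] where $a_\lambda$ is the number of standard Young tableaux $T$ of shape $\lambda$ whose smallest ascent is an even number.
   Context: Young diagrams are drawn in French notation: row $i$ (counted from the bottom) has $\lambda_i$ boxes. A standard Young tableau of shape $\lambda\vdash n$ is a filling of the diagram with the numbers $1,\ldots,n$, each used once, increasing along rows (left to right) and up columns (bottom to top). An entry $i$ of a standard Young tableau $T$ is a descent if $i+1$ lies in a row strictly above the row containing $i$; otherwise $i$ is an ascent (in particular the entry $n$ is always an ascent). $s_\lambda(x_1,\ldots,x_n)$ is the Schur polynomial in $n$ variables. *)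

theory Defs
  imports Main "HOL-Library.FuncSet" "HOL-Library.Poly_Mapping"
begin

text \<open>
  Polynomials with integer coefficients in variables indexed by natural numbers: an exponent
  vector is a finitely supported function \<open>nat \<Rightarrow>\<^sub>0 nat\<close>, and the multiplication on
  \<open>\<Rightarrow>\<^sub>0\<close> is convolution. The variables $x_1, \ldots, x_n$ are those with index in \<open>{1..n}\<close>.
\<close>

type_synonym int_mpoly = "(nat \<Rightarrow>\<^sub>0 nat) \<Rightarrow>\<^sub>0 int"

definition var :: "nat \<Rightarrow> int_mpoly" where
  "var i = Poly_Mapping.single (Poly_Mapping.single i 1) 1"

definition boolean_product :: "nat \<Rightarrow> nat \<Rightarrow> int_mpoly" where
  "boolean_product n k = (\<Prod>S\<in>{S. S \<subseteq> {1..n} \<and> card S = k}. \<Sum>i\<in>S. var i)"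

definition partitions :: "nat \<Rightarrow> nat list set" where
  "partitions n = {\<mu>. sorted_wrt (\<ge>) \<mu> \<and> (\<forall>p\<in>set \<mu>. 0 < p) \<and> sum_list \<mu> = n}"

text \<open>
  French notation: a cell is a pair (row, column), both counted from 0, with row 0 at the bottom.
\<close>

definition diagram :: "nat list \<Rightarrow> (nat \<times> nat) set" where
  "diagram \<mu> = {(r, c). r < length \<mu> \<and> c < \<mu> ! r}"

text \<open>
  A filling is a function on cells. It is required to be \<open>undefined\<close> off the diagram
  (\<open>extensional\<close>, \<open>\<rightarrow>\<^sub>E\<close>), so that distinct functions are distinct tableaux.
\<close>

definition syts :: "nat list \<Rightarrow> (nat \<times> nat \<Rightarrow> nat) set" where
  "syts \<mu> = {T. T \<in> extensional (diagram \<mu>) \<and>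
     bij_betw T (diagram \<mu>) {1..sum_list \<mu>} \<and>
     (\<forall>r c c'. (r, c) \<in> diagram \<mu> \<and> (r, c') \<in> diagram \<mu> \<and> c < c' \<longrightarrow> T (r, c) < T (r, c')) \<and>
     (\<forall>r r' c. (r, c) \<in> diagram \<mu> \<and> (r', c) \<in> diagram \<mu> \<and> r < r' \<longrightarrow> T (r, c) < T (r', c))}"

definition ssyts :: "nat \<Rightarrow> nat list \<Rightarrow> (nat \<times> nat \<Rightarrow> nat) set" where
  "ssyts n \<mu> = {T \<in> diagram \<mu> \<rightarrow>\<^sub>E {1..n}.
     (\<forall>r c c'. (r, c) \<in> diagram \<mu> \<and> (r, c') \<in> diagram \<mu> \<and> c < c' \<longrightarrow> T (r, c) \<le> T (r, c')) \<and>
     (\<forall>r r' c. (r, c) \<in> diagram \<mu> \<and> (r', c) \<in> diagram \<mu> \<and> r < r' \<longrightarrow> T (r, c) < T (r', c))}"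

text \<open>
  The Schur polynomial in $x_1, \ldots, x_n$, as the generating function of semistandard tableaux
  with entries in \<open>{1..n}\<close>.
\<close>

definition schur :: "nat \<Rightarrow> nat list \<Rightarrow> int_mpoly" where
  "schur n \<mu> = (\<Sum>T\<in>ssyts n \<mu>. \<Prod>b\<in>diagram \<mu>. var (T b))"

definition is_descent :: "nat list \<Rightarrow> (nat \<times> nat \<Rightarrow> nat) \<Rightarrow> nat \<Rightarrow> bool" where
  "is_descent \<mu> T i \<longleftrightarrow>
     (\<exists>r c r' c'. (r, c) \<in> diagram \<mu> \<and> (r', c') \<in> diagram \<mu> \<and>
        T (r, c) = i \<and> T (r', c') = i + 1 \<and> r < r')"

definition ascents :: "nat list \<Rightarrow> (nat \<times> nat \<Rightarrow> nat) \<Rightarrow> nat set" where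
  "ascents \<mu> T = {i \<in> {1..sum_list \<mu>}. \<not> is_descent \<mu> T i}"

text \<open>\<open>Min\<close> is applied to a finite set; the set is nonempty for a tableau with at least one cell,
  because its largest entry is an ascent.\<close>

definition smallest_ascent :: "nat list \<Rightarrow> (nat \<times> nat \<Rightarrow> nat) \<Rightarrow> nat" where
  "smallest_ascent \<mu> T = Min (ascents \<mu> T)"

definition even_ascent_count :: "nat list \<Rightarrow> nat" where
  "even_ascent_count \<mu> = card {T \<in> syts \<mu>. even (smallest_ascent \<mu> T)}"

text \<open>The index sets of the sums and cardinalities above are finite, so none of them
  collapses to the default value 0.\<close>

lemma finite_partitions: "finite (partitions n)"
proof (rule finite_subset)
  show "partitions n \<subseteq> {xs. set xs \<subseteq> {..n} \<and> length xs \<le> n}"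
  proof
    fix xs assume xs: "xs \<in> partitions n"
    have "length ys \<le> sum_list ys" if "\<forall>p\<in>set ys. 0 < p" for ys :: "nat list"
      using that by (induction ys) auto
    with xs show "xs \<in> {xs. set xs \<subseteq> {..n} \<and> length xs \<le> n}"
      by (auto simp: partitions_def intro: member_le_sum_list)
  qed
  show "finite {xs. set xs \<subseteq> {..n} \<and> length xs \<le> n}"
    by (rule finite_lists_length_le) simp
qed

lemma finite_diagram: "finite (diagram \<mu>)"
proof -
  have "diagram \<mu> = (SIGMA r:{..<length \<mu>}. {..<\<mu> ! r})"
    by (auto simp: diagram_def)
  then show ?thesis by simp
qed

lemma finite_ssyts: "finite (ssyts n \<mu>)"
  unfolding ssyts_def by (simp add: finite_PiE finite_diagram)

lemma finite_syts: "finite (syts \<mu>)"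
proof (rule finite_subset)
  show "syts \<mu> \<subseteq> diagram \<mu> \<rightarrow>\<^sub>E {1..sum_list \<mu>}"
    by (auto simp: syts_def PiE_def bij_betw_def)
  show "finite (diagram \<mu> \<rightarrow>\<^sub>E {1..sum_list \<mu>})"
    by (simp add: finite_PiE finite_diagram)
qed

lemma last_entry_is_ascent:
  assumes "T \<in> syts \<mu>" and "0 < sum_list \<mu>"
  shows "sum_list \<mu> \<in> ascents \<mu> T"
proof -
  have "T b \<le> sum_list \<mu>" if "b \<in> diagram \<mu>" for b
    using assms(1) that bij_betwE by (fastforce simp: syts_def)
  with assms(2) show ?thesis
    by (fastforce simp: ascents_def is_descent_def)
qed

end

theory Submission imports Defs begin

text \<open>
  With $p = x_1 + \cdots + x_n$ the product is $\prod_j (p - x_j) = \sum_k (-1)^k e_k\, p^{n-k}$.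
  Since $e_k = s_{1^k}$, multiplying by $p$ repeatedly and applying the Pieri rule expands
  $e_k\, p^{n-k}$ into Schur polynomials; the coefficient of $s_\lambda$ counts the ways of growing
  the column $1^k$ to $\lambda$ box by box, i.e. the standard tableaux in which $1, \ldots, k-1$ are
  descents. A tableau with smallest ascent $a$ is therefore counted $\sum_{k \le a} (-1)^k$ times,
  which is 1 for even $a$ and 0 for odd $a$.

  The Pieri rule for one box is proved by induction on the number of variables: the branching rule
  strips off the cells containing the largest entry, and what remains is a count of boxes that can
  be added to, or removed from, one of two interlacing partitions.
\<close>

section \<open>Shapes as weakly decreasing functions\<close>

definition cells :: "(nat \<Rightarrow> nat) \<Rightarrow> (nat \<times> nat) set" where
  "cells f = {(r, c). c < f r}"

text \<open>Partitions are padded with zero rows instead of being lists, so that adding a box, even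
  in a new row, is a plain function update and row indices need no bounds.\<close>

definition shapes :: "nat \<Rightarrow> (nat \<Rightarrow> nat) set" where
  "shapes n = {f. antimono f \<and> finite (cells f) \<and> card (cells f) = n}"

definition rows :: "nat list \<Rightarrow> nat \<Rightarrow> nat" where
  "rows \<mu> r = (if r < length \<mu> then \<mu> ! r else 0)"

text \<open>\<open>g \<in> strips f\<close> says that \<open>f/g\<close> is a horizontal strip; this interlacing condition already
  forces \<open>f\<close> and \<open>g\<close> to be weakly decreasing.\<close>

definition strips :: "(nat \<Rightarrow> nat) \<Rightarrow> (nat \<Rightarrow> nat) set" where
  "strips f = {g. \<forall>i. g i \<le> f i \<and> f (Suc i) \<le> g i}"

abbreviation add_box :: "(nat \<Rightarrow> nat) \<Rightarrow> nat \<Rightarrow> nat \<Rightarrow> nat" where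
  "add_box f i \<equiv> f(i := Suc (f i))"

definition addable :: "(nat \<Rightarrow> nat) \<Rightarrow> nat set" where
  "addable f = {i. antimono (add_box f i)}"

definition sst :: "nat \<Rightarrow> (nat \<Rightarrow> nat) \<Rightarrow> (nat \<times> nat \<Rightarrow> nat) set" where
  "sst n f = {T \<in> cells f \<rightarrow>\<^sub>E {1..n}.
     (\<forall>r c c'. (r, c) \<in> cells f \<and> (r, c') \<in> cells f \<and> c < c' \<longrightarrow> T (r, c) \<le> T (r, c')) \<and>
     (\<forall>r r' c. (r, c) \<in> cells f \<and> (r', c) \<in> cells f \<and> r < r' \<longrightarrow> T (r, c) < T (r', c))}"

text \<open>Evaluated at elements \<open>x i\<close> of an arbitrary commutative ring: the
  inductions below use ring arithmetic only, and \<open>x = var\<close> gives the polynomial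
  itself.\<close>

definition schur_fun :: "(nat \<Rightarrow> 'a::comm_ring_1) \<Rightarrow> nat \<Rightarrow> (nat \<Rightarrow> nat) \<Rightarrow> 'a" where
  "schur_fun x n f = (\<Sum>T\<in>sst n f. \<Prod>b\<in>cells f. x (T b))"

definition syt :: "nat \<Rightarrow> (nat \<Rightarrow> nat) \<Rightarrow> (nat \<times> nat \<Rightarrow> nat) set" where
  "syt n f = {T. T \<in> extensional (cells f) \<and> bij_betw T (cells f) {1..n} \<and>
     (\<forall>r c c'. (r, c) \<in> cells f \<and> (r, c') \<in> cells f \<and> c < c' \<longrightarrow> T (r, c) < T (r, c')) \<and>
     (\<forall>r r' c. (r, c) \<in> cells f \<and> (r', c) \<in> cells f \<and> r < r' \<longrightarrow> T (r, c) < T (r', c))}"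

definition descent :: "(nat \<Rightarrow> nat) \<Rightarrow> (nat \<times> nat \<Rightarrow> nat) \<Rightarrow> nat \<Rightarrow> bool" where
  "descent f T i \<longleftrightarrow> (\<exists>b\<in>cells f. \<exists>b'\<in>cells f. T b = i \<and> T b' = Suc i \<and> fst b < fst b')"

text \<open>For \<open>k = 0\<close> and \<open>k = 1\<close> the range of \<open>i\<close> is empty
  and all standard tableaux are counted, so these two terms cancel in the alternating sum.\<close>

definition syt_desc :: "nat \<Rightarrow> nat \<Rightarrow> (nat \<Rightarrow> nat) \<Rightarrow> (nat \<times> nat \<Rightarrow> nat) set" where
  "syt_desc k n f = {T \<in> syt n f. \<forall>i\<in>{1..<k}. descent f T i}"

definition column :: "nat \<Rightarrow> nat \<Rightarrow> nat" where
  "column k i = (if i < k then 1 else 0)"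

section \<open>Cells, and the dictionary between partitions as lists and as functions\<close>

lemma cells_iff [simp]: "(r, c) \<in> cells f \<longleftrightarrow> c < f r"
  by (simp add: cells_def)

lemma cells_inject: "cells f = cells g \<longleftrightarrow> f = g"
proof
  assume *: "cells f = cells g"
  have "c < f r \<longleftrightarrow> c < g r" for r c
    using * by (metis cells_iff)
  then show "f = g"
    by (metis ext linorder_neqE_nat less_irrefl)
qed simp

lemma cells_mono: "(\<And>i. g i \<le> f i) \<Longrightarrow> cells g \<subseteq> cells f"
  by (auto simp: cells_def intro: less_le_trans)

lemma cells_add_box: "cells (add_box f i) = insert (i, f i) (cells f)"
  by (auto simp: cells_def split: if_splits)

lemma cells_rows: "cells (rows \<mu>) = diagram \<mu>"
  by (auto simp: cells_def rows_def diagram_def split: if_splits)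

lemma card_diagram: "card (diagram \<mu>) = sum_list \<mu>"
proof -
  have "diagram \<mu> = (SIGMA r:{..<length \<mu>}. {..<\<mu> ! r})"
    by (auto simp: diagram_def)
  then show ?thesis
    by (simp add: sum_list_sum_nth atLeast0LessThan)
qed

lemma finite_cells_support: "finite (cells f) \<Longrightarrow> finite {i. 0 < f i}"
  by (rule finite_subset[of _ "fst ` cells f"]) (auto simp: image_iff cells_def)

text \<open>Parts are positive, so the support of the padded function is the index range of the list
  and determines its length.\<close>

lemma inj_on_rows: "inj_on rows (partitions n)"
proof (rule inj_onI)
  fix \<mu> \<nu> assume *: "\<mu> \<in> partitions n" "\<nu> \<in> partitions n" "rows \<mu> = rows \<nu>"
  have supp: "{i. 0 < rows \<xi> i} = {..<length \<xi>}" if "\<xi> \<in> partitions n" for \<xi>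
    using that by (auto simp: rows_def partitions_def split: if_splits)
  have "length \<mu> = length \<nu>"
    using supp[OF *(1)] supp[OF *(2)] *(3) by (metis card_lessThan)
  then show "\<mu> = \<nu>"
    by (rule nth_equalityI) (metis *(3) \<open>length \<mu> = length \<nu>\<close> rows_def)
qed

lemma rows_partitions: "rows ` partitions n = shapes n"
proof safe
  fix \<mu> assume \<mu>: "\<mu> \<in> partitions n"
  have "antimono (rows \<mu>)"
    using \<mu> by (intro antimonoI) (auto simp: rows_def partitions_def sorted_wrt_iff_nth_less le_less)
  with \<mu> show "rows \<mu> \<in> shapes n"
    by (simp add: shapes_def cells_rows finite_diagram card_diagram) (simp add: partitions_def)
next
  fix f assume f: "f \<in> shapes n"
  then have anti: "antimono f" and fin: "finite {i. 0 < f i}"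
    by (auto simp: shapes_def finite_cells_support)
  \<comment> \<open>\<open>L\<close> is the number of nonzero rows: finite support provides a zero
    row, and from the first one on all rows vanish by monotonicity.\<close>
  define L where "L = (LEAST i. f i = 0)"
  have "\<exists>i. f i = 0"
    using fin by (metis (mono_tags, lifting) UNIV_eq_I infinite_UNIV_nat mem_Collect_eq not_gr_zero)
  then have L0: "f L = 0"
    unfolding L_def by (rule LeastI_ex)
  have pos: "i < L \<Longrightarrow> 0 < f i" for i
    unfolding L_def using not_less_Least by blast
  define \<mu> where "\<mu> = map f [0..<L]"
  have rows: "rows \<mu> = f"
    using L0 antimonoD[OF anti, of L] by (auto simp: rows_def \<mu>_def fun_eq_iff not_less)
  have "sum_list \<mu> = n"
    using f by (simp flip: card_diagram cells_rows add: rows shapes_def)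
  moreover have "sorted_wrt (\<ge>) \<mu>"
    using antimonoD[OF anti] by (auto simp: \<mu>_def sorted_wrt_iff_nth_less)
  ultimately have "\<mu> \<in> partitions n"
    using pos by (auto simp: partitions_def \<mu>_def)
  with rows show "f \<in> rows ` partitions n"
    by blast
qed

lemma finite_shapes: "finite (shapes n)"
  by (metis rows_partitions finite_partitions finite_imageI)

lemma strips_cells_subset: "g \<in> strips f \<Longrightarrow> cells g \<subseteq> cells f"
  by (intro cells_mono) (simp add: strips_def)

lemma strips_antimono:
  assumes "g \<in> strips f"
  shows "antimono f" "antimono g"
proof -
  have "f (Suc i) \<le> g i" "g i \<le> f i" for i
    using assms by (auto simp: strips_def)
  then have "f (Suc i) \<le> f i" "g (Suc i) \<le> g i" for i
    by (meson le_trans)+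
  then show "antimono f" "antimono g"
    by (simp_all add: antimono_iff_le_Suc)
qed

text \<open>A function is determined by its cells, so \<open>strips f\<close> embeds into the power
  set of \<open>cells f\<close>.\<close>

lemma finite_strips:
  assumes "finite (cells f)"
  shows "finite (strips f)"
proof -
  have "strips f \<subseteq> {g. cells g \<in> Pow (cells f)}"
    by (auto simp: strips_def cells_def intro: less_le_trans)
  moreover have "finite {g. cells g \<in> Pow (cells f)}"
    using finite_vimageI[of "Pow (cells f)" cells] assms
    by (simp add: vimage_def inj_def cells_inject)
  ultimately show ?thesis
    by (rule finite_subset)
qed

lemma finite_sst: "finite (cells f) \<Longrightarrow> finite (sst n f)"
  unfolding sst_def by (simp add: finite_PiE)

lemma finite_syt: "finite (cells f) \<Longrightarrow> finite (syt n f)"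
  by (rule finite_subset[of _ "cells f \<rightarrow>\<^sub>E {1..n}"])
    (auto simp: syt_def PiE_def bij_betw_def intro!: finite_PiE[unfolded PiE_def])

section \<open>The branching rule\<close>

lemma sst_le: "T \<in> sst n f \<Longrightarrow> b \<in> cells f \<Longrightarrow> T b \<le> n"
  and sst_ge: "T \<in> sst n f \<Longrightarrow> b \<in> cells f \<Longrightarrow> Suc 0 \<le> T b"
  and sst_undefined: "T \<in> sst n f \<Longrightarrow> b \<notin> cells f \<Longrightarrow> T b = undefined"
  and sst_row: "T \<in> sst n f \<Longrightarrow> c < c' \<Longrightarrow> c' < f r \<Longrightarrow> T (r, c) \<le> T (r, c')"
  and sst_col: "T \<in> sst n f \<Longrightarrow> r < r' \<Longrightarrow> c < f r \<Longrightarrow> c < f r' \<Longrightarrow> T (r, c) < T (r', c)"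
  unfolding sst_def PiE_iff by (auto dest: extensional_arb)

lemma sstI:
  assumes "\<And>b. b \<in> cells f \<Longrightarrow> Suc 0 \<le> T b \<and> T b \<le> n" "\<And>b. b \<notin> cells f \<Longrightarrow> T b = undefined"
    and "\<And>r c c'. c < c' \<Longrightarrow> c' < f r \<Longrightarrow> T (r, c) \<le> T (r, c')"
    and "\<And>r r' c. r < r' \<Longrightarrow> c < f r \<Longrightarrow> c < f r' \<Longrightarrow> T (r, c) < T (r', c)"
  shows "T \<in> sst n f"
  using assms unfolding sst_def by (auto simp: PiE_iff extensional_def)

lemma down_closed_eq_lessThan:
  fixes A :: "nat set"
  assumes "finite A" and down: "\<And>a b. a \<in> A \<Longrightarrow> b < a \<Longrightarrow> b \<in> A"
  shows "A = {..<card A}"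
proof -
  have ex: "\<exists>k. k \<notin> A"
    using assms(1) by (metis UNIV_eq_I infinite_UNIV_nat)
  define k where "k = (LEAST k. k \<notin> A)"
  have "k \<notin> A"
    unfolding k_def by (rule LeastI_ex[OF ex])
  then have "a < k" if "a \<in> A" for a
    using that down[of a k] by (metis linorder_neqE_nat)
  moreover have "a \<in> A" if "a < k" for a
    using that not_less_Least unfolding k_def by blast
  ultimately have "A = {..<k}" by blast
  then show ?thesis by simp
qed

text \<open>The entries \<open>Suc n\<close> lie at the ends of rows, at most one per column, so
  they fill a horizontal strip \<open>f/g\<close> and contribute a power of
  \<open>x (Suc n)\<close>. The other entries form an arbitrary semistandard tableau of shape
  \<open>g\<close>.\<close>

lemma schur_fun_branching:
  assumes anti: "antimono f" and fin: "finite (cells f)"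
  shows "schur_fun x (Suc n) f =
    (\<Sum>g\<in>strips f. x (Suc n) ^ (card (cells f) - card (cells g)) * schur_fun x n g)"
proof -
  \<comment> \<open>\<open>sh T\<close> is the shape of the entries at most \<open>n\<close>.
    \<open>ext\<close> goes back, filling the cells of \<open>f\<close> outside \<open>g\<close>
    with \<open>Suc n\<close>. Row monotonicity makes the small entries of a row an initial segment,
    so counting them is enough.\<close>
  define sh where "sh T r = card {c. c < f r \<and> T (r, c) \<le> n}" for T r
  define ext where "ext = (\<lambda>(g, U) b. if b \<in> cells g then U b else if b \<in> cells f then Suc n else undefined)"
  have mem: "c < sh T r \<longleftrightarrow> c < f r \<and> T (r, c) \<le> n" if T: "T \<in> sst (Suc n) f" for T r c
  proof -
    let ?A = "{c. c < f r \<and> T (r, c) \<le> n}"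
    have down: "c' \<in> ?A" if "c \<in> ?A" "c' < c" for c c'
      using that sst_row[OF T, of c' c r] by auto
    have "?A = {..<card ?A}"
      by (rule down_closed_eq_lessThan) (use down in auto)
    then have "c \<in> ?A \<longleftrightarrow> c \<in> {..<card ?A}"
      by (rule arg_cong[where f = "\<lambda>S. c \<in> S"])
    then show ?thesis
      by (simp only: sh_def mem_Collect_eq lessThan_iff)
  qed
  have cells_sh: "cells (sh T) = {b \<in> cells f. T b \<le> n}" if "T \<in> sst (Suc n) f" for T
    using mem[OF that] by (auto simp: cells_def)
  have strip: "sh T \<in> strips f" if T: "T \<in> sst (Suc n) f" for T
  proof -
    \<comment> \<open>A cell with another cell directly above it holds an entry below that one,
      hence at most \<open>n\<close>.\<close>
    have le: "c < sh T i" if c: "c < f (Suc i)" for i c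
    proof -
      have "c < f i"
        using c antimonoD[OF anti, of i "Suc i"] by simp
      then have "T (i, c) < T (Suc i, c)" "T (Suc i, c) \<le> Suc n"
        using c sst_col[OF T, of i "Suc i" c] sst_le[OF T, of "(Suc i, c)"] by auto
      with \<open>c < f i\<close> show ?thesis
        by (simp add: mem[OF T])
    qed
    then have "f (Suc i) \<le> sh T i" for i
      using le[of "sh T i" i] by (metis leI less_irrefl)
    moreover have "sh T i \<le> f i" for i
      using mem[OF T, of "f i" i] by (simp add: not_less)
    ultimately show ?thesis
      by (simp add: strips_def)
  qed
  have restr: "restrict T (cells (sh T)) \<in> sst n (sh T)" if T: "T \<in> sst (Suc n) f" for T
  proof (rule sstI)
    fix b assume "b \<in> cells (sh T)"
    then show "Suc 0 \<le> restrict T (cells (sh T)) b \<and> restrict T (cells (sh T)) b \<le> n"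
      using cells_sh[OF T] sst_ge[OF T] by auto
  next
    fix r c c' assume "c < c'" "c' < sh T r"
    then show "restrict T (cells (sh T)) (r, c) \<le> restrict T (cells (sh T)) (r, c')"
      using sst_row[OF T, of c c' r] by (auto simp: mem[OF T])
  next
    fix r r' c assume "r < r'" "c < sh T r" "c < sh T r'"
    then show "restrict T (cells (sh T)) (r, c) < restrict T (cells (sh T)) (r', c)"
      using sst_col[OF T, of r r' c] by (auto simp: mem[OF T])
  qed simp
  have ext: "ext (g, U) \<in> sst (Suc n) f" if g: "g \<in> strips f" and U: "U \<in> sst n g" for g U
  proof -
    \<comment> \<open>Any cell of \<open>f\<close> below another cell of \<open>f\<close> lies in
      \<open>g\<close>, so no new entry \<open>Suc n\<close> has a cell above it.\<close>
    have col: "c < g r" if "c < f r'" "r < r'" for c r r'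
    proof -
      have "f (Suc r) \<le> g r"
        using g by (simp add: strips_def)
      moreover have "c < f (Suc r)"
        using that antimonoD[OF anti, of "Suc r" r'] by simp
      ultimately show ?thesis
        by simp
    qed
    show ?thesis
    proof (rule sstI)
      fix b assume "b \<in> cells f"
      then show "Suc 0 \<le> ext (g, U) b \<and> ext (g, U) b \<le> Suc n"
        using sst_le[OF U] sst_ge[OF U] by (auto simp: ext_def le_SucI)
    next
      fix b assume "b \<notin> cells f"
      then show "ext (g, U) b = undefined"
        using strips_cells_subset[OF g] by (auto simp: ext_def)
    next
      fix r c c' assume "c < c'" "c' < f r"
      then show "ext (g, U) (r, c) \<le> ext (g, U) (r, c')"
        using sst_row[OF U] sst_le[OF U, of "(r, c)"] by (auto simp: ext_def)
    next
      fix r r' c assume "r < r'" "c < f r" "c < f r'"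
      then show "ext (g, U) (r, c) < ext (g, U) (r', c)"
        using col[of c r' r] sst_col[OF U] sst_le[OF U, of "(r, c)"] by (auto simp: ext_def)
    qed
  qed
  have "schur_fun x (Suc n) f =
    (\<Sum>(g, U)\<in>Sigma (strips f) (sst n).
      x (Suc n) ^ (card (cells f) - card (cells g)) * (\<Prod>b\<in>cells g. x (U b)))"
    unfolding schur_fun_def
  proof (rule sum.reindex_bij_witness[where j = "\<lambda>T. (sh T, restrict T (cells (sh T)))" and i = ext], goal_cases)
    case (1 T)
    have "T b = Suc n" if "b \<in> cells f" "\<not> T b \<le> n" for b
      using that sst_le[OF 1, of b] by simp
    then show ?case
      using sst_undefined[OF 1] by (auto simp: ext_def cells_sh[OF 1] fun_eq_iff)
  next
    case (2 T)
    then show ?case using strip restr by simp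
  next
    case (3 p)
    then obtain g U where p: "p = (g, U)" and g: "g \<in> strips f" and U: "U \<in> sst n g" by auto
    have "T b \<le> n \<longleftrightarrow> b \<in> cells g" if "T = ext (g, U)" "b \<in> cells f" for T b
      using that sst_le[OF U] by (auto simp: ext_def)
    then have "cells (sh (ext (g, U))) = cells g"
      using strips_cells_subset[OF g] by (auto simp: cells_sh[OF ext[OF g U]])
    moreover have "restrict (ext (g, U)) (cells g) = U"
      using sst_undefined[OF U] by (auto simp: ext_def restrict_def)
    ultimately show ?case
      by (simp add: p cells_inject)
  next
    case (4 p)
    then show ?case using ext by auto
  next
    case (5 T)
    let ?g = "cells (sh T)"
    have gf: "?g \<subseteq> cells f"
      using strips_cells_subset strip[OF 5] by blast
    \<comment> \<open>The weights agree because every cell outside the smaller shape carries the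
      largest variable.\<close>
    have "T b = Suc n" if b: "b \<in> cells f - ?g" for b
    proof -
      have "\<not> T b \<le> n"
        using b by (simp add: cells_sh[OF 5])
      with sst_le[OF 5, of b] b show ?thesis by simp
    qed
    then have "(\<Prod>b\<in>cells f - ?g. x (T b)) = x (Suc n) ^ (card (cells f) - card ?g)"
      using gf fin by (simp add: card_Diff_subset finite_subset)
    then show ?case
      using prod.subset_diff[OF gf fin, of "\<lambda>b. x (T b)"] by simp
  qed
  also have "\<dots> = (\<Sum>g\<in>strips f. x (Suc n) ^ (card (cells f) - card (cells g)) * schur_fun x n g)"
    unfolding schur_fun_def sum_distrib_left
    by (rule sum.Sigma[symmetric]) (use finite_strips[OF fin] finite_sst finite_subset[OF strips_cells_subset fin] in blast)+
  finally show ?thesis .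
qed

section \<open>The Pieri rule for a single box\<close>

lemma sst_empty: "cells f = {} \<Longrightarrow> sst n f = {\<lambda>_. undefined}"
  by (auto simp: sst_def PiE_def)

lemma schur_fun_empty: "cells f = {} \<Longrightarrow> schur_fun x n f = 1"
  by (simp add: schur_fun_def sst_empty)

lemma schur_fun_0:
  assumes "cells f \<noteq> {}"
  shows "schur_fun x 0 f = 0"
proof -
  have "sst 0 f = {}"
    using assms sst_le[of _ 0 f] sst_ge[of _ 0 f] by fastforce
  then show ?thesis
    by (simp add: schur_fun_def)
qed

text \<open>A box fits in row \<open>Suc j\<close> only if row \<open>j\<close> is nonempty, which
  leaves finitely many rows.\<close>

lemma finite_addable:
  assumes "finite (cells f)"
  shows "finite (addable f)"
proof -
  have "addable f \<subseteq> insert 0 (Suc ` {i. 0 < f i})"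
  proof
    fix i assume i: "i \<in> addable f"
    show "i \<in> insert 0 (Suc ` {i. 0 < f i})"
    proof (cases i)
      case (Suc j)
      then have "Suc (f i) \<le> f j"
        using i antimonoD[of "add_box f i" j i] by (simp add: addable_def)
      with Suc show ?thesis by auto
    qed simp
  qed
  then show ?thesis
    using finite_cells_support[OF assms] by (meson finite_imageI finite_insert finite_subset)
qed

lemma finite_cells_add_box: "finite (cells f) \<Longrightarrow> finite (cells (add_box f i))"
  by (simp only: cells_add_box finite_insert)

lemma card_cells_add_box: "finite (cells f) \<Longrightarrow> card (cells (add_box f i)) = Suc (card (cells f))"
  by (simp add: cells_add_box)

lemma strips_iff: "g \<in> strips f \<longleftrightarrow> (\<forall>i. g i \<le> f i) \<and> (\<forall>i. f (Suc i) \<le> g i)"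
  by (auto simp: strips_def)

text \<open>
  If \<open>f/h\<close> is a horizontal strip, it remains one after adding a box to row \<open>Suc j\<close> of \<open>f\<close>
  exactly when it does after removing one from row \<open>j\<close> of \<open>h\<close>, and row 0 of \<open>f\<close> is always free. Otherwise both sides ask for
  the single violated inequality to be repaired, in the same row.
\<close>

lemma card_add_box_strips:
  assumes f: "antimono f" and h: "antimono h" and fin: "finite (cells h)"
  shows "card {i. h \<in> strips (add_box f i)} =
    card {j. 0 < h j \<and> h(j := h j - 1) \<in> strips f} + (if h \<in> strips f then 1 else 0)"
    (is "card ?A = card ?B + _")
proof (cases "h \<in> strips f")
  case True
  then have hf: "h i \<le> f i" "f (Suc i) \<le> h i" for i
    by (auto simp: strips_def)
  have A: "i \<in> ?A \<longleftrightarrow> i = 0 \<or> (\<exists>j. i = Suc j \<and> f (Suc j) < h j)" for i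
    using hf by (cases i) (auto simp: strips_def Suc_le_eq le_SucI)
  have B: "j \<in> ?B \<longleftrightarrow> f (Suc j) < h j" for j
  proof
    assume j: "j \<in> ?B"
    then have "f (Suc j) \<le> h j - 1"
      by (auto simp: strips_def dest!: spec[of _ j])
    with j show "f (Suc j) < h j" by auto
  next
    assume "f (Suc j) < h j"
    then show "j \<in> ?B"
      using hf le_trans[OF diff_le_self hf(1)] by (auto simp: strips_def)
  qed
  have "?A = insert 0 (Suc ` ?B)"
    using A B by blast
  moreover have "finite ?B"
    by (rule finite_subset[OF _ finite_cells_support[OF fin]]) auto
  ultimately show ?thesis
    using True by (simp add: card_image)
next
  case False
  have "i \<in> ?A \<longleftrightarrow> h i = Suc (f i) \<and> (\<forall>j. j \<noteq> i \<longrightarrow> h j \<le> f j) \<and> (\<forall>j. f (Suc j) \<le> h j)" for i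
  proof
    assume i: "i \<in> ?A"
    then have 1: "h j \<le> (add_box f i) j" "(add_box f i) (Suc j) \<le> h j" for j
      by (auto simp: strips_def)
    have 2: "j \<noteq> i \<Longrightarrow> h j \<le> f j" "f (Suc j) \<le> h j" for j
      using 1[of j] by (auto split: if_splits)
    have "\<not> h i \<le> f i"
      using False 2 by (metis strips_iff)
    with 1(1)[of i] 2 show "h i = Suc (f i) \<and> (\<forall>j. j \<noteq> i \<longrightarrow> h j \<le> f j) \<and> (\<forall>j. f (Suc j) \<le> h j)"
      by simp
  next
    assume i: "h i = Suc (f i) \<and> (\<forall>j. j \<noteq> i \<longrightarrow> h j \<le> f j) \<and> (\<forall>j. f (Suc j) \<le> h j)"
    \<comment> \<open>The raised row \<open>i\<close> of \<open>f\<close> has length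
      \<open>h i\<close>, which is at most \<open>h j\<close> because \<open>h\<close> is weakly
      decreasing.\<close>
    have "Suc (f i) \<le> h j" if "i = Suc j" for j
      using i antimonoD[OF h, of j i] that by simp
    with i show "i \<in> ?A"
      unfolding mem_Collect_eq strips_iff by (auto simp: le_SucI)
  qed
  moreover have "i \<in> ?B \<longleftrightarrow> h i = Suc (f i) \<and> (\<forall>j. j \<noteq> i \<longrightarrow> h j \<le> f j) \<and> (\<forall>j. f (Suc j) \<le> h j)" for i
  proof
    assume i: "i \<in> ?B"
    then have 1: "(h(i := h i - 1)) j \<le> f j" "f (Suc j) \<le> (h(i := h i - 1)) j" for j
      by (auto simp: strips_def)
    have 2: "j \<noteq> i \<Longrightarrow> h j \<le> f j" "f (Suc j) \<le> h j" for j
      using 1[of j] by (auto split: if_splits)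
    have "\<not> h i \<le> f i"
      using False 2 by (metis strips_iff)
    with 1(1)[of i] 2 show "h i = Suc (f i) \<and> (\<forall>j. j \<noteq> i \<longrightarrow> h j \<le> f j) \<and> (\<forall>j. f (Suc j) \<le> h j)"
      by simp
  next
    assume i: "h i = Suc (f i) \<and> (\<forall>j. j \<noteq> i \<longrightarrow> h j \<le> f j) \<and> (\<forall>j. f (Suc j) \<le> h j)"
    \<comment> \<open>The lowered row \<open>i\<close> of \<open>h\<close> has length
      \<open>f i\<close>, which is at least \<open>f (Suc i)\<close> because \<open>f\<close> is
      weakly decreasing.\<close>
    then show "i \<in> ?B"
      using antimonoD[OF f, of i "Suc i"] unfolding mem_Collect_eq strips_iff by auto
  qed
  ultimately have "?A = ?B"
    by blast
  with False show ?thesis by simp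
qed

text \<open>Double counting: collect the terms \<open>F h\<close> on both sides. The multiplicities
  of \<open>h\<close> are the two counts compared in \<open>card_add_box_strips\<close>, and the
  last sum supplies the extra 1.\<close>

lemma pieri_sum:
  fixes F :: "(nat \<Rightarrow> nat) \<Rightarrow> 'a::comm_ring_1"
  assumes f: "antimono f" and fin: "finite (cells f)"
  shows "(\<Sum>i\<in>addable f. \<Sum>h\<in>strips (add_box f i). F h) =
    (\<Sum>g\<in>strips f. \<Sum>j\<in>addable g. F (add_box g j)) + (\<Sum>g\<in>strips f. F g)"
proof -
  \<comment> \<open>\<open>R\<close> gathers every \<open>h\<close> that occurs on either side,
    giving one finite index set over which the sums can be exchanged.\<close>
  define R where "R = (\<Union>i\<in>addable f. strips (add_box f i)) \<union> (\<Union>g\<in>strips f. add_box g ` addable g) \<union> strips f"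
  have fing: "finite (cells g)" if "g \<in> strips f" for g
    using strips_cells_subset[OF that] fin by (rule finite_subset)
  have finR: "finite R"
    using fin fing unfolding R_def
    by (intro finite_UnI finite_UN_I finite_imageI finite_addable finite_strips finite_cells_add_box) auto
  have R: "antimono h \<and> finite (cells h)" if "h \<in> R" for h
    using that unfolding R_def
  proof (elim UnE UN_E imageE)
    fix i assume h: "h \<in> strips (add_box f i)"
    show ?thesis
      using strips_antimono(2)[OF h] finite_subset[OF strips_cells_subset[OF h] finite_cells_add_box[OF fin]] by (rule conjI)
  next
    fix g j assume "g \<in> strips f" "h = add_box g j" "j \<in> addable g"
    with finite_cells_add_box[OF fing] show ?thesis
      by (simp add: addable_def)
  next
    assume h: "h \<in> strips f"
    show ?thesis
      using strips_antimono(2)[OF h] fing[OF h] by (rule conjI)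
  qed
  define A where "A h = {i. h \<in> strips (add_box f i)}" for h
  define B where "B h = {j. 0 < h j \<and> h(j := h j - 1) \<in> strips f}" for h
  have finB: "finite (B h)" if "h \<in> R" for h
    using R[OF that] by (intro finite_subset[OF _ finite_cells_support]) (auto simp: B_def)
  have "(\<Sum>i\<in>addable f. \<Sum>h\<in>strips (add_box f i). F h) =
      (\<Sum>i\<in>addable f. \<Sum>h | h \<in> R \<and> h \<in> strips (add_box f i). F h)"
    by (intro sum.cong refl) (auto simp: R_def)
  also have "\<dots> = (\<Sum>h\<in>R. \<Sum>i | i \<in> addable f \<and> h \<in> strips (add_box f i). F h)"
    by (intro sum.swap_restrict finite_addable fin finR)
  also have "\<dots> = (\<Sum>h\<in>R. of_nat (card (A h)) * F h)"
  proof (rule sum.cong)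
    fix h
    \<comment> \<open>Addability comes for free: interlacing with \<open>h\<close> already forces
      \<open>add_box f i\<close> to be weakly decreasing.\<close>
    have "{i. i \<in> addable f \<and> h \<in> strips (add_box f i)} = A h"
      using strips_antimono(1) by (auto simp: A_def addable_def)
    then show "(\<Sum>i | i \<in> addable f \<and> h \<in> strips (add_box f i). F h) = of_nat (card (A h)) * F h"
      by simp
  qed simp
  also have "\<dots> = (\<Sum>h\<in>R. of_nat (card (B h)) * F h + (if h \<in> strips f then F h else 0))"
    using R by (intro sum.cong refl)
      (auto simp: A_def B_def card_add_box_strips[OF f] distrib_right)
  also have "\<dots> = (\<Sum>h\<in>R. of_nat (card (B h)) * F h) + (\<Sum>g\<in>strips f. F g)"
    using finR by (simp add: sum.distrib R_def Int_absorb1 flip: sum.inter_restrict)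
  also have "(\<Sum>h\<in>R. of_nat (card (B h)) * F h) = (\<Sum>(h, j)\<in>Sigma R B. F h)"
    using finR finB by (simp flip: sum.Sigma)
  \<comment> \<open>Removing the last box of row \<open>j\<close> from \<open>h\<close> is inverse
    to adding one to row \<open>j\<close> of \<open>g\<close>.\<close>
  also have "\<dots> = (\<Sum>(g, j)\<in>Sigma (strips f) addable. F (add_box g j))"
  proof (rule sum.reindex_bij_witness[where j = "\<lambda>(h, j). (h(j := h j - 1), j)"
        and i = "\<lambda>(g, j). (add_box g j, j)"], goal_cases)
    case (2 p)
    then show ?case
      using R by (auto simp: B_def addable_def)
  next
    case (4 p)
    then show ?case
      by (auto simp: B_def R_def)
  qed (auto simp: B_def)
  also have "\<dots> = (\<Sum>g\<in>strips f. \<Sum>j\<in>addable g. F (add_box g j))"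
    by (rule sum.Sigma[symmetric]) (auto simp: finite_strips fin fing finite_addable)
  finally show ?thesis .
qed

lemma schur_fun_pieri:
  assumes "antimono f" and "finite (cells f)"
  shows "schur_fun x n f * (\<Sum>i=1..n. x i) = (\<Sum>i\<in>addable f. schur_fun x n (add_box f i))"
  using assms
proof (induction n arbitrary: f)
  case 0
  have "cells (add_box f i) \<noteq> {}" for i
    by (simp only: cells_add_box insert_not_empty not_False_eq_True)
  then have "(\<Sum>i\<in>addable f. schur_fun x 0 (add_box f i)) = 0"
    by (intro sum.neutral ballI schur_fun_0)
  then show ?case
    unfolding \<open>_ = 0\<close> by simp
next
  case (Suc n)
  let ?y = "x (Suc n)" and ?c = "card (cells f)"
  \<comment> \<open>\<open>F h\<close> is the term of \<open>h\<close> in the branching rule for any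
    shape with \<open>Suc ?c\<close> cells, thus for every \<open>add_box f i\<close> at
    once.\<close>
  define F where "F h = ?y ^ (Suc ?c - card (cells h)) * schur_fun x n h" for h
  have g: "antimono g" "finite (cells g)" "card (cells g) \<le> ?c" if "g \<in> strips f" for g
    using that strips_antimono(2) strips_cells_subset[OF that] Suc.prems(2)
    by (auto intro: finite_subset card_mono)
  have "schur_fun x (Suc n) f * (\<Sum>i=1..Suc n. x i) =
      (\<Sum>g\<in>strips f. ?y ^ (?c - card (cells g)) * (schur_fun x n g * (\<Sum>i=1..n. x i))
         + ?y * ?y ^ (?c - card (cells g)) * schur_fun x n g)"
    unfolding schur_fun_branching[OF Suc.prems] sum_distrib_right
    by (intro sum.cong refl) (simp add: algebra_simps)
  \<comment> \<open>The first \<open>n\<close> variables act through the induction hypothesis, and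
    the extra cell of \<open>add_box g j\<close> keeps the exponent at
    \<open>?c - card (cells g)\<close>. The last variable raises the exponent by one and yields
    \<open>F g\<close>.\<close>
  also have "\<dots> = (\<Sum>g\<in>strips f. (\<Sum>j\<in>addable g. F (add_box g j)) + F g)"
  proof (rule sum.cong[OF refl])
    fix h assume h: "h \<in> strips f"
    show "?y ^ (?c - card (cells h)) * (schur_fun x n h * (\<Sum>i=1..n. x i))
         + ?y * ?y ^ (?c - card (cells h)) * schur_fun x n h = (\<Sum>j\<in>addable h. F (add_box h j)) + F h"
      unfolding Suc.IH[OF g(1,2)[OF h]] using g(3)[OF h]
      by (simp add: F_def sum_distrib_left card_cells_add_box[OF g(2)[OF h]] Suc_diff_le)
  qed
  also have "\<dots> = (\<Sum>i\<in>addable f. \<Sum>h\<in>strips (add_box f i). F h)"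
    by (simp add: pieri_sum[OF Suc.prems] sum.distrib)
  also have "\<dots> = (\<Sum>i\<in>addable f. schur_fun x (Suc n) (add_box f i))"
  proof (rule sum.cong)
    fix i assume "i \<in> addable f"
    then have "antimono (add_box f i)"
      by (simp add: addable_def)
    then show "(\<Sum>h\<in>strips (add_box f i). F h) = schur_fun x (Suc n) (add_box f i)"
      using Suc.prems(2)
      by (simp add: schur_fun_branching finite_cells_add_box card_cells_add_box F_def)
  qed simp
  finally show ?case .
qed

section \<open>Elementary symmetric polynomials as column Schur polynomials\<close>

lemma cells_column: "cells (column k) = (\<lambda>i. (i, 0)) ` {..<k}"
  by (auto simp: cells_def column_def split: if_splits)

lemma antimono_column: "antimono (column k)"
  by (auto simp: column_def intro!: antimonoI)

lemma finite_cells_column: "finite (cells (column k))"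
  by (simp add: cells_column)

lemma card_cells_column: "card (cells (column k)) = k"
  by (simp add: cells_column card_image inj_on_def)

lemma column_shapes: "column k \<in> shapes k"
  by (simp add: shapes_def antimono_column finite_cells_column card_cells_column)

lemma cells_column_0: "cells (column 0) = {}"
  by (simp add: cells_column)

text \<open>Inside a single column a horizontal strip has at most one cell, which must be the top
  one.\<close>

lemma strips_column: "strips (column (Suc k)) = {column (Suc k), column k}"
proof
  show "{column (Suc k), column k} \<subseteq> strips (column (Suc k))"
    by (auto simp: strips_def column_def)
  show "strips (column (Suc k)) \<subseteq> {column (Suc k), column k}"
  proof
    fix g assume "g \<in> strips (column (Suc k))"
    then have g: "g i \<le> (if i < Suc k then 1 else 0)" "(if i < k then 1 else 0) \<le> g i" for i
      by (auto simp: strips_def column_def)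
    have lo: "g i = 1" if "i < k" for i
      using g[of i] that by simp
    have hi: "g i = 0" if "k < i" for i
      using g(1)[of i] that by simp
    have "g k = 0 \<or> g k = 1"
      using g(1)[of k] by auto
    then show "g \<in> {column (Suc k), column k}"
    proof
      assume "g k = 0"
      then have "g = column k"
        using lo hi by (intro ext) (metis column_def linorder_neqE_nat less_irrefl)
      then show ?thesis by simp
    next
      assume "g k = 1"
      then have "g = column (Suc k)"
        using lo hi by (intro ext) (metis column_def linorder_neqE_nat less_Suc_eq not_less_eq)
      then show ?thesis by simp
    qed
  qed
qed

lemma column_inject: "column k = column l \<longleftrightarrow> k = l"
  by (metis card_cells_column)

text \<open>This is the recursion of elementary symmetric polynomials: the last variable is either
  absent or used once.\<close>

lemma schur_fun_column_Suc:
  "schur_fun x (Suc n) (column (Suc k)) =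
    schur_fun x n (column (Suc k)) + x (Suc n) * schur_fun x n (column k)"
  by (simp add: schur_fun_branching antimono_column finite_cells_column strips_column
      column_inject card_cells_column)

lemma schur_fun_column_0: "schur_fun x n (column 0) = 1"
  by (rule schur_fun_empty[OF cells_column_0])

lemma schur_fun_column_eq_0: "n < k \<Longrightarrow> schur_fun x n (column k) = 0"
proof (induction n arbitrary: k)
  case 0
  then show ?case
    by (intro schur_fun_0) (auto simp: cells_column)
next
  case (Suc n)
  then obtain l where "k = Suc l" "n < l"
    by (cases k) auto
  with Suc.IH show ?case
    by (simp add: schur_fun_column_Suc)
qed

text \<open>Vieta's expansion. Multiplying by the next factor combines neighbouring coefficients
  exactly as in the column recursion.\<close>

lemma prod_diff_schur_column:
  "(\<Prod>j=1..n. z - x j) = (\<Sum>k\<le>n. (-1) ^ k * schur_fun x n (column k) * z ^ (n - k))"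
proof (induction n)
  case 0
  show ?case by (simp add: schur_fun_column_0)
next
  case (Suc n)
  let ?E = "\<lambda>k. schur_fun x n (column k)" and ?y = "x (Suc n)"
  let ?s = "\<Sum>k\<le>n. (-1) ^ k * ?E k * z ^ (n - k)"
  have "z * ?s = (\<Sum>k\<le>n. (-1) ^ k * ?E k * z ^ (Suc n - k))"
    by (simp add: sum_distrib_left Suc_diff_le algebra_simps)
  \<comment> \<open>The added term vanishes, since a column of \<open>Suc n\<close> cells cannot be
    filled strictly from \<open>n\<close> values.\<close>
  also have "\<dots> = (\<Sum>k\<le>Suc n. (-1) ^ k * ?E k * z ^ (Suc n - k))"
    by (simp add: schur_fun_column_eq_0)
  also have "\<dots> = z ^ Suc n - (\<Sum>k\<le>n. (-1) ^ k * ?E (Suc k) * z ^ (n - k))"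
    by (subst sum.atMost_Suc_shift) (simp add: schur_fun_column_0 sum_negf)
  finally have z: "z * ?s = z ^ Suc n - (\<Sum>k\<le>n. (-1) ^ k * ?E (Suc k) * z ^ (n - k))" .
  have "(\<Prod>j=1..Suc n. z - x j) = ?s * (z - ?y)"
    unfolding Suc.IH[symmetric] by simp
  also have "\<dots> = z * ?s - ?y * ?s"
    by (simp only: mult.commute[of ?s] left_diff_distrib)
  also have "\<dots> = z ^ Suc n - (\<Sum>k\<le>n. (-1) ^ k * (?E (Suc k) + ?y * ?E k) * z ^ (n - k))"
    unfolding z by (simp add: sum_distrib_left sum.distrib algebra_simps)
  also have "\<dots> = (\<Sum>k\<le>Suc n. (-1) ^ k * schur_fun x (Suc n) (column k) * z ^ (Suc n - k))"
    by (subst sum.atMost_Suc_shift)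
      (simp add: schur_fun_column_0 schur_fun_column_Suc sum_negf)
  finally show ?case .
qed

section \<open>Growing standard tableaux\<close>

lemma sytI:
  assumes "bij_betw T (cells f) {1..n}" "\<And>b. b \<notin> cells f \<Longrightarrow> T b = undefined"
    and "\<And>r c c'. c < c' \<Longrightarrow> c' < f r \<Longrightarrow> T (r, c) < T (r, c')"
    and "\<And>r r' c. r < r' \<Longrightarrow> c < f r \<Longrightarrow> c < f r' \<Longrightarrow> T (r, c) < T (r', c)"
  shows "T \<in> syt n f"
  using assms unfolding syt_def extensional_def by auto

lemma syt_bij: "T \<in> syt n f \<Longrightarrow> bij_betw T (cells f) {1..n}"
  and syt_undefined: "T \<in> syt n f \<Longrightarrow> b \<notin> cells f \<Longrightarrow> T b = undefined"
  and syt_row: "T \<in> syt n f \<Longrightarrow> c < c' \<Longrightarrow> c' < f r \<Longrightarrow> T (r, c) < T (r, c')"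
  and syt_col: "T \<in> syt n f \<Longrightarrow> r < r' \<Longrightarrow> c < f r \<Longrightarrow> c < f r' \<Longrightarrow> T (r, c) < T (r', c)"
  unfolding syt_def by (auto dest: extensional_arb)

lemma syt_le: "T \<in> syt n f \<Longrightarrow> b \<in> cells f \<Longrightarrow> T b \<le> n"
  using bij_betwE[OF syt_bij] by fastforce

lemma syt_inj: "T \<in> syt n f \<Longrightarrow> b \<in> cells f \<Longrightarrow> b' \<in> cells f \<Longrightarrow> T b = T b' \<Longrightarrow> b = b'"
  using inj_onD[OF bij_betw_imp_inj_on[OF syt_bij]] by blast

lemma add_box_shapes: "g \<in> shapes m \<Longrightarrow> i \<in> addable g \<Longrightarrow> add_box g i \<in> shapes (Suc m)"
  by (simp add: shapes_def addable_def finite_cells_add_box card_cells_add_box)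

lemma add_entry_syt:
  assumes g: "antimono g" and T: "T \<in> syt m g" and i: "i \<in> addable g"
  shows "T((i, g i) := Suc m) \<in> syt (Suc m) (add_box g i)"
proof (rule sytI)
  have "bij_betw (T((i, g i) := Suc m)) (cells g) {1..m}"
    using syt_bij[OF T] by (rule bij_betw_cong[THEN iffD1, rotated]) auto
  then have "bij_betw (T((i, g i) := Suc m)) (cells g \<union> {(i, g i)}) ({1..m} \<union> {(T((i, g i) := Suc m)) (i, g i)})"
    by (intro notIn_Un_bij_betw) auto
  moreover have "{1..m} \<union> {(T((i, g i) := Suc m)) (i, g i)} = {1..Suc m}"
    by auto
  ultimately show "bij_betw (T((i, g i) := Suc m)) (cells (add_box g i)) {1..Suc m}"
    by (simp only: cells_add_box Un_insert_right Un_empty_right)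
next
  fix b assume b: "b \<notin> cells (add_box g i)"
  then show "(T((i, g i) := Suc m)) b = undefined"
    unfolding cells_add_box using syt_undefined[OF T] by auto
next
  fix r c c' assume c: "c < c'" "c' < (add_box g i) r"
  then have "c < g r"
    by (auto split: if_splits)
  moreover from this have "T (r, c) \<le> m"
    using syt_le[OF T, of "(r, c)"] by simp
  ultimately show "(T((i, g i) := Suc m)) (r, c) < (T((i, g i) := Suc m)) (r, c')"
    using c syt_row[OF T, of c c' r] by (auto split: if_splits)
next
  fix r r' c assume c: "r < r'" "c < (add_box g i) r" "c < (add_box g i) r'"
  \<comment> \<open>The new cell has no cell above it: that would make a higher row of
    \<open>g\<close> longer than row \<open>i\<close>.\<close>
  have "\<not> (r = i \<and> c = g i)"
    using c antimonoD[OF g, of r r'] by auto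
  then have "c < g r"
    using c(2) by (auto split: if_splits)
  moreover from this have "T (r, c) \<le> m"
    using syt_le[OF T, of "(r, c)"] by simp
  ultimately show "(T((i, g i) := Suc m)) (r, c) < (T((i, g i) := Suc m)) (r', c)"
    using c syt_col[OF T, of r r' c] by (auto split: if_splits)
qed

text \<open>Both \<open>j\<close> and \<open>Suc j\<close> are at most \<open>m\<close>, so the new
  entry \<open>Suc m\<close> is neither of them.\<close>

lemma descent_add_entry:
  assumes j: "Suc j \<le> m"
  shows "descent (add_box g i) (T((i, g i) := Suc m)) j \<longleftrightarrow> descent g T j"
proof -
  obtain T' where T': "T' = T((i, g i) := Suc m)" by blast
  have "T' (i, g i) = Suc m"
    by (simp add: T')
  moreover have "T' b = T b" if "b \<in> cells g" for b
    using that by (auto simp: T')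
  ultimately show ?thesis
    unfolding descent_def cells_add_box T'[symmetric] using j
    by (simp cong: bex_cong)
qed

text \<open>The largest entry sits at the end of its row, and no cell lies above it.\<close>

lemma remove_entry_syt:
  assumes f: "f \<in> shapes (Suc m)" and T: "T \<in> syt (Suc m) f"
  obtains g i U where "g \<in> shapes m" "i \<in> addable g" "U \<in> syt m g"
    "f = add_box g i" "T = U((i, g i) := Suc m)"
proof -
  have anti: "antimono f" and fin: "finite (cells f)" and card: "card (cells f) = Suc m"
    using f by (auto simp: shapes_def)
  obtain i c where c: "c < f i" and Tic: "T (i, c) = Suc m"
    using bij_betw_imp_surj_on[OF syt_bij[OF T]]
    by (metis (no_types, lifting) atLeastAtMost_iff cells_iff imageE le_refl le_add1 plus_1_eq_Suc surj_pair)
  have fi: "f i = Suc c"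
  proof (rule ccontr)
    assume "f i \<noteq> Suc c"
    with c have "Suc c < f i" by simp
    then show False
      using syt_row[OF T, of c "Suc c" i] syt_le[OF T, of "(i, Suc c)"] Tic by simp
  qed
  have above: "f (Suc i) \<le> c"
  proof (rule ccontr)
    assume "\<not> f (Suc i) \<le> c"
    then show False
      using syt_col[OF T, of i "Suc i" c] syt_le[OF T, of "(Suc i, c)"] Tic c by simp
  qed
  define g where "g = f(i := c)"
  have f_eq: "f = add_box g i" and gi: "g i = c"
    by (auto simp: g_def fi)
  have cells_f: "cells f = insert (i, c) (cells g)" and notin: "(i, c) \<notin> cells g"
    using f_eq cells_add_box[of g i] gi by auto
  \<comment> \<open>Resetting the removed cell to \<open>undefined\<close> keeps \<open>U\<close>
    extensional on the smaller diagram.\<close>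
  define U where "U = T((i, c) := undefined)"
  have T_eq: "T = U((i, g i) := Suc m)"
    using Tic by (auto simp: U_def gi)
  have "g (Suc j) \<le> g j" for j
    using antimonoD[OF anti, of j "Suc j"] above fi by (auto simp: g_def)
  then have "antimono g"
    by (simp add: antimono_iff_le_Suc)
  moreover have "finite (cells g)" "card (cells g) = m"
    using fin card notin by (auto simp: cells_f)
  ultimately have "g \<in> shapes m"
    by (simp add: shapes_def)
  moreover have "i \<in> addable g"
    using anti f_eq by (simp add: addable_def)
  moreover have "U \<in> syt m g"
  proof (rule sytI)
    have "bij_betw T (cells f - {(i, c)}) ({1..Suc m} - {T (i, c)})"
      using syt_bij[OF T] cells_f by (intro bij_betw_DiffI) (auto simp: Tic)
    moreover have "{1..Suc m} - {T (i, c)} = {1..m}"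
      by (auto simp: Tic)
    ultimately have "bij_betw T (cells g) {1..m}"
      using notin by (simp add: cells_f)
    then show "bij_betw U (cells g) {1..m}"
      by (rule bij_betw_cong[THEN iffD1, rotated]) (use notin in \<open>auto simp: U_def\<close>)
  next
    fix b assume "b \<notin> cells g"
    then show "U b = undefined"
      using syt_undefined[OF T, of b] by (auto simp: U_def cells_f)
  next
    fix r c1 c2 assume "c1 < c2" "c2 < g r"
    then show "U (r, c1) < U (r, c2)"
      using syt_row[OF T, of c1 c2 r] fi by (auto simp: U_def g_def split: if_splits)
  next
    fix r r' c1 assume "r < r'" "c1 < g r" "c1 < g r'"
    then show "U (r, c1) < U (r', c1)"
      using syt_col[OF T, of r r' c1] fi by (auto simp: U_def g_def split: if_splits)
  qed
  ultimately show thesis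
    using f_eq T_eq that by blast
qed

text \<open>Inserting \<open>Suc m\<close> into an addable cell and deleting the largest entry are
  mutually inverse. As \<open>k \<le> m\<close>, the prescribed descents involve only entries up to
  \<open>m\<close> and survive in both directions.\<close>

lemma sum_syt_desc_Suc:
  fixes F :: "(nat \<Rightarrow> nat) \<Rightarrow> 'a::comm_ring_1"
  assumes "k \<le> m"
  shows "(\<Sum>f\<in>shapes (Suc m). \<Sum>T\<in>syt_desc k (Suc m) f. F f) =
    (\<Sum>g\<in>shapes m. \<Sum>U\<in>syt_desc k m g. \<Sum>i\<in>addable g. F (add_box g i))"
proof -
  have fin: "finite (cells f)" if "f \<in> shapes l" for f l
    using that by (simp add: shapes_def)
  have fin': "finite (syt_desc k l f)" if "f \<in> shapes l" for f l
    using finite_syt[OF fin[OF that]] by (simp add: syt_desc_def)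
  define h where "h = (\<lambda>(g, U, i). (add_box g i, U((i, g i) := Suc m)))"
  let ?X = "SIGMA g:shapes m. syt_desc k m g \<times> addable g"
  let ?Y = "Sigma (shapes (Suc m)) (syt_desc k (Suc m))"
  have desc: "(\<forall>j\<in>{1..<k}. descent (add_box g i) (U((i, g i) := Suc m)) j) \<longleftrightarrow> (\<forall>j\<in>{1..<k}. descent g U j)" for g i U
    using assms by (intro ball_cong refl descent_add_entry) auto
  have "bij_betw h ?X ?Y"
    unfolding bij_betw_def
  proof
    show "inj_on h ?X"
    proof (rule inj_onI)
      fix p p' assume "p \<in> ?X" "p' \<in> ?X" "h p = h p'"
      then obtain g U i g' U' i' where p: "p = (g, U, i)" "p' = (g', U', i')"
        and U: "g \<in> shapes m" "U \<in> syt_desc k m g" "g' \<in> shapes m" "U' \<in> syt_desc k m g'"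
        and eq: "h (g, U, i) = h (g', U', i')"
        by (elim SigmaE) auto
      let ?f = "add_box g i" and ?T = "U((i, g i) := Suc m)"
      have U': "U \<in> syt m g" "U' \<in> syt m g'"
        using U by (auto simp: syt_desc_def)
      have f: "?f = add_box g' i'" and T: "?T = U'((i', g' i') := Suc m)"
        using eq by (auto simp: h_def)
      \<comment> \<open>The added cell can be recovered from the result: any other cell of the shape
        lies in \<open>g\<close>, where \<open>U\<close> stays at most \<open>m\<close>.\<close>
      have *: "(i', g' i') = (i, g i)"
      proof (rule ccontr)
        assume ne: "(i', g' i') \<noteq> (i, g i)"
        have "(i', g' i') \<in> cells ?f"
          by (simp only: f cells_add_box insertI1)
        with ne have "(i', g' i') \<in> cells g"
          by (metis cells_add_box insertE)
        then have "U (i', g' i') \<le> m"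
          by (rule syt_le[OF U'(1)])
        moreover have "U (i', g' i') = Suc m"
          using T ne by (metis fun_upd_other fun_upd_same)
        ultimately show False by simp
      qed
      then have "i' = i" "g' i' = g i" by auto
      have "g = g'"
      proof
        fix r
        show "g r = g' r"
          using fun_cong[OF f, of r] * by (auto split: if_splits)
      qed
      moreover have "U = U'"
      proof
        fix b
        show "U b = U' b"
        proof (cases "b = (i, g i)")
          case True
          then show ?thesis
            using syt_undefined[OF U'(1), of b] syt_undefined[OF U'(2), of b] \<open>g = g'\<close> by simp
        next
          case False
          then show ?thesis
            using fun_cong[OF T, of b] * by (auto split: if_splits)
        qed
      qed
      ultimately show "p = p'"
        using * by (simp add: p)
    qed
    show "h ` ?X = ?Y"
    proof (intro equalityI subsetI)
      fix p assume "p \<in> h ` ?X"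
      then obtain g U i where p: "p = (add_box g i, U((i, g i) := Suc m))"
        and g: "g \<in> shapes m" "U \<in> syt_desc k m g" "i \<in> addable g"
        by (auto simp: h_def)
      then have "U((i, g i) := Suc m) \<in> syt_desc k (Suc m) (add_box g i)"
        using add_entry_syt[of g U m i] desc[of g i U] by (simp add: syt_desc_def shapes_def)
      with add_box_shapes[OF g(1,3)] show "p \<in> ?Y"
        unfolding p mem_Sigma_iff by (rule conjI)
    next
      fix p assume "p \<in> ?Y"
      then obtain f T where p: "p = (f, T)" and f: "f \<in> shapes (Suc m)" and T: "T \<in> syt (Suc m) f"
        and dT: "\<forall>j\<in>{1..<k}. descent f T j"
        by (auto simp: syt_desc_def)
      obtain g i U where g: "g \<in> shapes m" "i \<in> addable g" "U \<in> syt m g"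
        and eq: "f = add_box g i" "T = U((i, g i) := Suc m)"
        using remove_entry_syt[OF f T] .
      have "U \<in> syt_desc k m g"
        using g dT desc[of g i U] by (simp add: syt_desc_def eq)
      with g have "(g, U, i) \<in> ?X" by simp
      moreover have "p = h (g, U, i)"
        by (simp add: h_def p eq)
      ultimately show "p \<in> h ` ?X" by blast
    qed
  qed
  then have "(\<Sum>(g, U, i)\<in>?X. F (add_box g i)) = (\<Sum>(f, T)\<in>?Y. F f)"
    by (intro sum.reindex_bij_betw[of h, THEN trans[rotated]] sum.cong) (auto simp: h_def)
  moreover have "(\<Sum>f\<in>shapes (Suc m). \<Sum>T\<in>syt_desc k (Suc m) f. F f) = (\<Sum>(f, T)\<in>?Y. F f)"
    using finite_shapes fin' by (intro sum.Sigma) auto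
  moreover have "(\<Sum>g\<in>shapes m. \<Sum>U\<in>syt_desc k m g. \<Sum>i\<in>addable g. F (add_box g i)) = (\<Sum>(g, U, i)\<in>?X. F (add_box g i))"
    unfolding sum.cartesian_product using finite_shapes fin' finite_addable[OF fin]
    by (intro sum.Sigma) auto
  ultimately show ?thesis by simp
qed

section \<open>Tableaux in which every entry but the largest is a descent\<close>

lemma strict_mono_lessThan_eq:
  fixes u :: "nat \<Rightarrow> nat"
  assumes bij: "bij_betw u {..<k} {..<k}" and mono: "\<And>i j. i < j \<Longrightarrow> j < k \<Longrightarrow> u i < u j" and "i < k"
  shows "u i = i"
proof -
  \<comment> \<open>The values of \<open>u\<close> in order form a sorted list without repetition,
    and such a list is determined by its set.\<close>
  have "map u [0..<k] = [0..<k]"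
  proof (rule sorted_distinct_set_unique)
    show "sorted (map u [0..<k])"
      using mono by (auto simp: sorted_iff_nth_mono le_less)
    show "distinct (map u [0..<k])"
      using bij by (auto simp: distinct_map bij_betw_def atLeast0LessThan)
    show "set (map u [0..<k]) = set [0..<k]"
      using bij by (auto simp: bij_betw_def atLeast0LessThan)
  qed simp_all
  then show ?thesis
    using \<open>i < k\<close> by (metis add_0 diff_zero length_upt nth_map nth_upt)
qed

definition column_tableau :: "nat \<Rightarrow> nat \<times> nat \<Rightarrow> nat" where
  "column_tableau k b = (if b \<in> cells (column k) then Suc (fst b) else undefined)"

lemma column_tableau_syt_desc: "column_tableau k \<in> syt_desc k k (column k)"
proof -
  have "column_tableau k \<in> syt k (column k)"
  proof (rule sytI)
    have "bij_betw (\<lambda>b. Suc (fst b)) (cells (column k)) {1..k}"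
      unfolding cells_column
      by (rule bij_betwI[where g = "\<lambda>j. (j - 1, 0)"]) auto
    then show "bij_betw (column_tableau k) (cells (column k)) {1..k}"
      by (rule bij_betw_cong[THEN iffD1, rotated]) (simp add: column_tableau_def)
  qed (auto simp: column_tableau_def column_def split: if_splits)
  moreover have "descent (column k) (column_tableau k) i" if "i \<in> {1..<k}" for i
    unfolding descent_def
    by (rule bexI[of _ "(i - 1, 0)"], rule bexI[of _ "(i, 0)"])
      (use that in \<open>auto simp: column_tableau_def column_def\<close>)
  ultimately show ?thesis
    by (simp add: syt_desc_def)
qed

text \<open>If all of \<open>1, ..., k - 1\<close> are descents, larger entries lie in strictly
  higher rows. No two cells then share a row, so the shape is a column, and its increasing filling
  is forced.\<close>

lemma syt_desc_full:
  assumes f: "f \<in> shapes k" and T: "T \<in> syt_desc k k f"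
  shows "f = column k" "T = column_tableau k"
proof -
  have anti: "antimono f" and fin: "finite (cells f)" and card: "card (cells f) = k"
    using f by (auto simp: shapes_def)
  have T': "T \<in> syt k f" and desc: "\<And>i. 1 \<le> i \<Longrightarrow> i < k \<Longrightarrow> descent f T i"
    using T by (auto simp: syt_desc_def)
  have step: "fst b < fst b'" if "b \<in> cells f" "b' \<in> cells f" "T b' = Suc (T b)" for b b'
  proof -
    have "1 \<le> T b" "T b < k"
      using bij_betwE[OF syt_bij[OF T']] that by fastforce+
    then obtain d d' where d: "d \<in> cells f" "d' \<in> cells f" "T d = T b" "T d' = Suc (T b)" "fst d < fst d'"
      using desc[of "T b"] by (auto simp: descent_def)
    then have "d = b" "d' = b'"
      using syt_inj[OF T'] that by auto
    with d show ?thesis by simp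
  qed
  \<comment> \<open>Descents compare consecutive entries only; induction on the difference passes
    through the cell holding each intermediate value.\<close>
  have less: "fst b < fst b'" if "b \<in> cells f" "b' \<in> cells f" "T b' = T b + Suc j" for b b' j
    using that
  proof (induction j arbitrary: b')
    case 0
    then show ?case using step by simp
  next
    case (Suc j)
    have "T b + Suc j \<in> {1..k}"
      using syt_le[OF T' Suc.prems(2)] Suc.prems(3) by simp
    then obtain d where d: "d \<in> cells f" "T d = T b + Suc j"
      using bij_betw_imp_surj_on[OF syt_bij[OF T']] by (metis (no_types, lifting) imageE)
    have "fst b < fst d"
      using Suc.IH[OF Suc.prems(1) d] .
    also have "\<dots> < fst b'"
      using step[OF d(1) Suc.prems(2)] d(2) Suc.prems(3) by simp
    finally show ?case .
  qed
  have f1: "f r \<le> 1" for r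
  proof (rule ccontr)
    assume "\<not> f r \<le> 1"
    then have "T (r, 0) < T (r, 1)"
      using syt_row[OF T', of 0 1 r] by simp
    then obtain j where "T (r, 1) = T (r, 0) + Suc j"
      using less_imp_Suc_add by auto
    with \<open>\<not> f r \<le> 1\<close> show False
      using less[of "(r, 0)" "(r, 1)" j] by simp
  qed
  have cells_f: "cells f = (\<lambda>r. (r, 0)) ` {r. 0 < f r}"
  proof (intro equalityI subsetI)
    fix b assume "b \<in> cells f"
    then obtain r c where "b = (r, c)" "c < f r"
      by (cases b) auto
    with f1[of r] show "b \<in> (\<lambda>r. (r, 0)) ` {r. 0 < f r}" by auto
  qed auto
  have "{r. 0 < f r} = {..<card {r. 0 < f r}}"
    using finite_cells_support[OF fin] antimonoD[OF anti]
    by (intro down_closed_eq_lessThan) (auto intro: less_le_trans)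
  moreover have "card {r. 0 < f r} = k"
    using card by (simp add: cells_f card_image inj_on_def)
  ultimately have "{r. 0 < f r} = {..<k}" by simp
  then have "cells f = cells (column k)"
    by (simp add: cells_f cells_column)
  then show fk: "f = column k"
    by (simp add: cells_inject)
  have bij: "bij_betw T (cells (column k)) {1..k}"
    using syt_bij[OF T'] fk by simp
  \<comment> \<open>Shifting the entries down by one turns the column into an increasing permutation
    of \<open>{..<k}\<close>, which is the identity.\<close>
  define u where "u i = T (i, 0) - 1" for i
  have "bij_betw (\<lambda>i. (i, 0)) {..<k} (cells (column k))"
    by (simp add: cells_column bij_betw_def inj_on_def)
  from bij_betw_trans[OF this bij] have "bij_betw (\<lambda>i. T (i, 0)) {..<k} {1..k}"
    by (simp add: comp_def)
  moreover have "bij_betw (\<lambda>j. j - 1) {1..k} {..<k}"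
    by (rule bij_betwI[where g = Suc]) auto
  moreover have "u = (\<lambda>j. j - 1) \<circ> (\<lambda>i. T (i, 0))"
    by (simp add: fun_eq_iff u_def)
  ultimately have "bij_betw u {..<k} {..<k}"
    using bij_betw_trans by metis
  moreover have pos: "1 \<le> T (i, 0)" if "i < k" for i
    using bij_betwE[OF bij] that by (fastforce simp: column_def)
  have "u i < u j" if "i < j" "j < k" for i j
    using syt_col[OF T', of i j 0] that pos[of i] by (simp add: u_def fk column_def)
  ultimately have "u i = i" if "i < k" for i
    using that by (rule strict_mono_lessThan_eq)
  then have "T (i, 0) = Suc i" if "i < k" for i
    using that pos[of i] by (fastforce simp: u_def)
  then show "T = column_tableau k"
    using syt_undefined[OF T'] by (auto simp: fun_eq_iff column_tableau_def fk column_def split: if_splits)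
qed

text \<open>Induction on the size \<open>n\<close> with the number \<open>N\<close> of variables
  fixed. At \<open>n = k\<close> only the column survives, with one tableau; each further factor
  adds a box by the Pieri rule, recorded as the next entry.\<close>

lemma schur_column_times_power:
  assumes "k \<le> n"
  shows "schur_fun x N (column k) * (\<Sum>i=1..N. x i) ^ (n - k) =
    (\<Sum>f\<in>shapes n. of_nat (card (syt_desc k n f)) * schur_fun x N f)"
  using assms
proof (induction n rule: dec_induct)
  case base
  have "(\<Sum>f\<in>shapes k. of_nat (card (syt_desc k k f)) * schur_fun x N f) =
    (\<Sum>f\<in>{column k}. of_nat (card (syt_desc k k f)) * schur_fun x N f)"
  proof (rule sum.mono_neutral_right[OF finite_shapes])
    show "\<forall>f\<in>shapes k - {column k}. of_nat (card (syt_desc k k f)) * schur_fun x N f = 0"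
    proof
      fix f assume "f \<in> shapes k - {column k}"
      then have "syt_desc k k f = {}"
        using syt_desc_full(1) by blast
      then show "of_nat (card (syt_desc k k f)) * schur_fun x N f = 0"
        by simp
    qed
  qed (simp add: column_shapes)
  moreover have "syt_desc k k (column k) = {column_tableau k}"
    using column_tableau_syt_desc syt_desc_full(2)[OF column_shapes] by blast
  ultimately show ?case by simp
next
  case (step m)
  have "schur_fun x N (column k) * (\<Sum>i=1..N. x i) ^ (Suc m - k) =
      (\<Sum>g\<in>shapes m. of_nat (card (syt_desc k m g)) * (schur_fun x N g * (\<Sum>i=1..N. x i)))"
    unfolding Suc_diff_le[OF step(1)] power_Suc2 mult.assoc[symmetric] step.IH sum_distrib_right ..
  also have "\<dots> = (\<Sum>g\<in>shapes m. \<Sum>U\<in>syt_desc k m g. \<Sum>i\<in>addable g. schur_fun x N (add_box g i))"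
    by (intro sum.cong refl) (simp add: shapes_def flip: schur_fun_pieri)
  also have "\<dots> = (\<Sum>f\<in>shapes (Suc m). of_nat (card (syt_desc k (Suc m) f)) * schur_fun x N f)"
    by (subst sum_syt_desc_Suc[symmetric]) (use step in auto)
  finally show ?case .
qed

section \<open>The alternating sum\<close>

lemma syt_rows: "\<mu> \<in> partitions n \<Longrightarrow> syt n (rows \<mu>) = syts \<mu>"
  unfolding syt_def syts_def cells_rows by (simp add: partitions_def)

lemma schur_rows: "schur n \<mu> = schur_fun var n (rows \<mu>)"
  unfolding schur_def schur_fun_def ssyts_def sst_def cells_rows ..

lemma descent_rows: "descent (rows \<mu>) T i \<longleftrightarrow> is_descent \<mu> T i"
  unfolding descent_def is_descent_def cells_rows by force

lemma sum_alternating: "(\<Sum>k\<le>a. (-1) ^ k) = (if even a then 1 else 0 :: 'a::comm_ring_1)"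
  by (induction a) auto

text \<open>All of \<open>1, ..., k - 1\<close> are descents exactly when no ascent is below
  \<open>k\<close>. The entry \<open>n\<close> is an ascent, so the minimum is taken over a nonempty
  set and is at most \<open>n\<close>.\<close>

lemma syt_desc_iff_smallest_ascent:
  assumes \<mu>: "\<mu> \<in> partitions n" and "0 < n" and T: "T \<in> syts \<mu>"
  shows "smallest_ascent \<mu> T \<le> n"
    and "k \<le> n \<Longrightarrow> T \<in> syt_desc k n (rows \<mu>) \<longleftrightarrow> k \<le> smallest_ascent \<mu> T"
proof -
  have n: "sum_list \<mu> = n"
    using \<mu> by (simp add: partitions_def)
  have fin: "finite (ascents \<mu> T)"
    by (simp add: ascents_def)
  have asc: "n \<in> ascents \<mu> T"
    using last_entry_is_ascent[OF T] n \<open>0 < n\<close> by simp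
  show "smallest_ascent \<mu> T \<le> n"
    using Min_le[OF fin asc] by (simp add: smallest_ascent_def)
  show "T \<in> syt_desc k n (rows \<mu>) \<longleftrightarrow> k \<le> smallest_ascent \<mu> T" if "k \<le> n"
  proof -
    have "k \<le> smallest_ascent \<mu> T \<longleftrightarrow> (\<forall>i\<in>ascents \<mu> T. k \<le> i)"
      unfolding smallest_ascent_def using fin asc by (intro Min_ge_iff) auto
    \<comment> \<open>By \<open>k \<le> n\<close>, each \<open>i\<close> in \<open>{1..<k}\<close>
      is an entry of the tableau, so failing to be a descent makes it an ascent.\<close>
    also have "\<dots> \<longleftrightarrow> (\<forall>i\<in>{1..<k}. is_descent \<mu> T i)"
      using that by (fastforce simp: ascents_def n)
    finally show ?thesis
      using T by (simp add: syt_desc_def syt_rows[OF \<mu>] descent_rows)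
  qed
qed

lemma alternating_sum_syt_desc:
  assumes \<mu>: "\<mu> \<in> partitions n" and "0 < n"
  shows "(\<Sum>k\<le>n. (-1) ^ k * of_nat (card (syt_desc k n (rows \<mu>)))) =
    (of_nat (even_ascent_count \<mu>) :: 'a::comm_ring_1)"
proof -
  let ?a = "smallest_ascent \<mu>"
  have "(\<Sum>k\<le>n. (-1) ^ k * of_nat (card (syt_desc k n (rows \<mu>)))) =
      (\<Sum>k\<le>n. \<Sum>T\<in>syts \<mu>. if k \<le> ?a T then (-1) ^ k else 0 :: 'a)"
  proof (rule sum.cong[OF refl])
    fix k assume "k \<in> {..n}"
    then have "syt_desc k n (rows \<mu>) = {T \<in> syts \<mu>. k \<le> ?a T}"
      using syt_desc_iff_smallest_ascent(2)[OF assms] syt_rows[OF \<mu>]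
      by (auto simp: syt_desc_def)
    then show "(-1) ^ k * of_nat (card (syt_desc k n (rows \<mu>))) =
        (\<Sum>T\<in>syts \<mu>. if k \<le> ?a T then (-1) ^ k else 0 :: 'a)"
      by (simp add: finite_syts mult.commute flip: sum.inter_filter)
  qed
  also have "\<dots> = (\<Sum>T\<in>syts \<mu>. \<Sum>k\<le>n. if k \<le> ?a T then (-1) ^ k else 0)"
    by (rule sum.swap)
  also have "\<dots> = (\<Sum>T\<in>syts \<mu>. if even (?a T) then 1 else 0)"
  proof (rule sum.cong[OF refl])
    fix T assume "T \<in> syts \<mu>"
    \<comment> \<open>The smallest ascent is at most \<open>n\<close>, so the bound
      \<open>k \<le> n\<close> does not cut off the alternating sum.\<close>
    then have "{k \<in> {..n}. k \<le> ?a T} = {..?a T}"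
      using syt_desc_iff_smallest_ascent(1)[OF assms, of T] by auto
    then show "(\<Sum>k\<le>n. if k \<le> ?a T then (-1) ^ k else 0) = (if even (?a T) then 1 else 0 :: 'a)"
      by (simp add: sum_alternating flip: sum.inter_filter)
  qed
  also have "\<dots> = of_nat (even_ascent_count \<mu>)"
    by (simp add: even_ascent_count_def finite_syts flip: sum.inter_filter)
  finally show ?thesis .
qed

text \<open>A subset of size \<open>n - 1\<close> is the complement of one index \<open>j\<close>,
  so its sum is the full sum minus \<open>var j\<close>.\<close>

lemma boolean_product_pred:
  assumes "0 < n"
  shows "boolean_product n (n - 1) = (\<Prod>j=1..n. (\<Sum>i=1..n. var i) - var j)"
proof -
  have "bij_betw (\<lambda>j. {1..n} - {j}) {1..n} {S. S \<subseteq> {1..n} \<and> card S = n - 1}"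
    unfolding bij_betw_def
  proof (intro conjI equalityI subsetI)
    show "inj_on (\<lambda>j. {1..n} - {j}) {1..n}"
      by (rule inj_onI) blast
    fix S assume S: "S \<in> {S. S \<subseteq> {1..n} \<and> card S = n - 1}"
    then have "card ({1..n} - S) = 1"
      using assms by (simp add: card_Diff_subset finite_subset[of S "{1..n}"])
    then obtain j where "{1..n} - S = {j}"
      by (rule card_1_singletonE)
    with S have "j \<in> {1..n}" "S = {1..n} - {j}" by blast+
    then show "S \<in> (\<lambda>j. {1..n} - {j}) ` {1..n}" by blast
  qed auto
  then show ?thesis
    unfolding boolean_product_def
    by (subst prod.reindex_bij_betw[symmetric], assumption) (simp add: sum_diff1)
qed

theorem theorem3p1:
  fixes n :: nat
  assumes "n \<ge> 2"
  shows "boolean_product n (n - 1) =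
    (\<Sum>\<mu>\<in>partitions n. of_nat (even_ascent_count \<mu>) * schur n \<mu>)"
proof -
  let ?p = "\<Sum>i=1..n. var i" and ?S = "schur_fun var n"
  \<comment> \<open>The Vieta expansion is taken at \<open>z = ?p\<close>, the sum of all
    variables.\<close>
  have "boolean_product n (n - 1) = (\<Sum>k\<le>n. (-1) ^ k * (?S (column k) * ?p ^ (n - k)))"
    using assms by (subst boolean_product_pred) (simp, simp only: prod_diff_schur_column mult.assoc)
  also have "\<dots> = (\<Sum>k\<le>n. \<Sum>f\<in>shapes n. (-1) ^ k * of_nat (card (syt_desc k n f)) * ?S f)"
    by (intro sum.cong refl) (simp only: schur_column_times_power atMost_iff sum_distrib_left mult.assoc)
  \<comment> \<open>Exchanging the sums isolates the coefficient of each Schur polynomial as an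
    alternating count of tableaux.\<close>
  also have "\<dots> = (\<Sum>f\<in>shapes n. (\<Sum>k\<le>n. (-1) ^ k * of_nat (card (syt_desc k n f))) * ?S f)"
    by (subst sum.swap) (simp only: sum_distrib_right)
  also have "\<dots> = (\<Sum>\<mu>\<in>partitions n. (\<Sum>k\<le>n. (-1) ^ k * of_nat (card (syt_desc k n (rows \<mu>)))) * ?S (rows \<mu>))"
    by (simp only: rows_partitions[symmetric] sum.reindex[OF inj_on_rows] comp_def)
  also have "\<dots> = (\<Sum>\<mu>\<in>partitions n. of_nat (even_ascent_count \<mu>) * schur n \<mu>)"
    using assms by (intro sum.cong refl) (simp add: alternating_sum_syt_desc schur_rows)
  finally show ?thesis .
qed

end
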